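(* Let $D_\star=([4],\mathcal F_\star)$, where \[ \mathcal F_\star=\{\varnothing,\{4\}\}\cup\binom{[4]}{2}\cup\{[4]\}. \] Then $D_\star$ is a delta-matroid. Its delta-matroid polytope is \[ P_\star=\operatorname{conv}\{0000,0001,1100,1010,1001,0110,0101,0011,1111\}\subset\mathbb{R}^4, \] and $P_\star$ does not have the integer decomposition property. The vertices of $P_\star$ affinely generate $\mathbb{Z}^4$, so $P_\star$ is also not normal. Thus, $P_\star$ has no unimodular triangulation.
   Context: Here $[n]=\{1,\ldots,n\}$, $\binom{[4]}{2}$ is the set of two-element subsets of $[4]$, and a string such as $1100$ denotes the vector $(1,1,0,0)$. A delta-matroid on $[n]$ is a pair $D=([n],\mathcal F)$ with $\varnothing\neq\mathcal F\subseteq 2^{[n]}$ such that for all $X,Y\in\mathcal F$ and every $u\in X\triangle Y$ there exists $v\in X\triangle Y$, possibly $v=u$, with $X\triangle\{u,v\}\in\mathcal F$. Its delta-matroid polytope is $P(D)=\operatorname{conv}\{\mathbf 1_F:F\in\mathcal F\}\subset[0,1]^n$. A lattice polytope $P\subset\mathbb{R}^d$ has the integer decomposition property if for every $k\ge1$ every point of $kP\cap\mathbb{Z}^d$ is a sum of $k$ points of $P\cap\mathbb{Z}^d$. With $A=P\cap\mathbb{Z}^d$ and $K$ a field, the toric ring $K[P]$ is the image of $K[x_a:a\in A]\to K[t,z_1^{\pm1},\ldots,z_d^{\pm1}]$, $x_a\mapsto tz^a$; $P$ is normal if $K[P]$ is a normal domain. A set of lattice points affinely generates $\mathbb{Z}^d$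 if every point of $\mathbb{Z}^d$ is an integer affine combination (coefficients summing to $1$) of them. A triangulation (with lattice points as vertices) of a $d$-dimensional lattice polytope is unimodular if every maximal simplex has normalized volume one (that is, $d!$ times its Euclidean volume is $1$). *)

theory Defs
  imports
    "HOL-Analysis.Analysis"
    "HOL-Library.Poly_Mapping"
    "HOL-Computational_Algebra.Polynomial"
    "HOL-Computational_Algebra.Fraction_Field"
begin

section \<open>Delta-matroids and their polytopes\<close>

definition delta_matroid :: "'a set \<Rightarrow> 'a set set \<Rightarrow> bool" where
  "delta_matroid E F \<longleftrightarrow>
     finite E \<and> F \<noteq> {} \<and> F \<subseteq> Pow E \<and>
     (\<forall>X\<in>F. \<forall>Y\<in>F. \<forall>u\<in>sym_diff X Y. \<exists>v\<in>sym_diff X Y. sym_diff X {u, v} \<in> F)"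

text \<open>
  The ground set \<open>[n]\<close> is the index type of \<open>\<real>\<^sup>n\<close>, so that \<open>F\<close> is a family of sets of indices.
\<close>

definition indicator_vec :: "'n set \<Rightarrow> real ^ 'n" where
  "indicator_vec S = (\<chi> i. if i \<in> S then 1 else 0)"

definition delta_matroid_polytope :: "'n set set \<Rightarrow> (real ^ 'n) set" where
  "delta_matroid_polytope F = convex hull (indicator_vec ` F)"


section \<open>Lattice points, integer decomposition, affine generation\<close>

definition int_lattice :: "(real ^ 'n) set" where
  "int_lattice = {x. \<forall>i. x $ i \<in> \<int>}"

definition integer_decomposition_property :: "(real ^ 'n) set \<Rightarrow> bool" where
  "integer_decomposition_property P \<longleftrightarrow>
     (\<forall>k::nat. k \<ge> 1 \<longrightarrow>
       (\<forall>x \<in> (\<lambda>p. real k *\<^sub>R p) ` P \<inter> int_lattice.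
         \<exists>ps. length ps = k \<and> set ps \<subseteq> P \<inter> int_lattice \<and> x = sum_list ps))"

definition affinely_generates_lattice :: "(real ^ 'n) set \<Rightarrow> bool" where
  "affinely_generates_lattice S \<longleftrightarrow>
     S \<subseteq> int_lattice \<and>
     (\<forall>x \<in> int_lattice. \<exists>T (c :: real ^ 'n \<Rightarrow> int).
        finite T \<and> T \<subseteq> S \<and> (\<Sum>v\<in>T. c v) = 1 \<and> x = (\<Sum>v\<in>T. of_int (c v) *\<^sub>R v))"


section \<open>The toric ring and normality\<close>

text \<open>
  \<open>('n \<Rightarrow>\<^sub>0 int) \<Rightarrow>\<^sub>0 'k\<close> is the Laurent polynomial ring \<open>K[z\<^sub>i\<^sup>\<plusminus>\<^sup>1]\<close> (finitely supported functions on the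
  exponents \<open>\<int>\<^sup>d\<close>, with convolution product); univariate polynomials over it, in the variable \<open>t\<close>,
  give \<open>K[t, z\<^sub>i\<^sup>\<plusminus>\<^sup>1]\<close>.  The linear order on \<open>'n\<close> serves only to obtain the library's \<open>idom\<close> instance
  for Laurent polynomials.
\<close>

type_synonym ('n, 'k) laurent = "('n \<Rightarrow>\<^sub>0 int) \<Rightarrow>\<^sub>0 'k"

text \<open>
  \<open>z_monomial a\<close> is \<open>z\<^sup>a\<close>.  It is only meant for \<open>a\<close> with integer coordinates, where the floor merely
  converts them to type \<open>int\<close>.
\<close>

definition z_monomial :: "real ^ 'n \<Rightarrow> ('n, 'k::comm_ring_1) laurent" where
  "z_monomial a = Poly_Mapping.single (Abs_poly_mapping (\<lambda>i. \<lfloor>a $ i\<rfloor>)) 1"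

text \<open>
  The polynomial ring \<open>K[x\<^sub>a : a \<in> A]\<close>: an element maps monomials (exponent vectors, finitely
  supported functions from variables to \<open>nat\<close>) to coefficients; only variables in \<open>A\<close> may occur.
\<close>

definition polynomial_ring :: "'x set \<Rightarrow> (('x \<Rightarrow>\<^sub>0 nat) \<Rightarrow>\<^sub>0 'k::comm_ring_1) set" where
  "polynomial_ring A = {f. \<forall>m \<in> Poly_Mapping.keys f. Poly_Mapping.keys m \<subseteq> A}"

definition toric_hom ::
    "((real ^ 'n::{finite,linorder} \<Rightarrow>\<^sub>0 nat) \<Rightarrow>\<^sub>0 'k::comm_ring_1) \<Rightarrow> ('n, 'k) laurent poly" where
  "toric_hom f =
     (\<Sum>m \<in> Poly_Mapping.keys f.
        [: Poly_Mapping.single 0 (Poly_Mapping.lookup f m) :] *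
        (\<Prod>a \<in> Poly_Mapping.keys m. monom (z_monomial a) 1 ^ Poly_Mapping.lookup m a))"

definition toric_ring ::
    "(real ^ 'n::{finite,linorder}) set \<Rightarrow> ('n, 'k::comm_ring_1) laurent poly set" where
  "toric_ring P = toric_hom ` polynomial_ring (P \<inter> int_lattice)"

definition integral_over :: "'a::comm_ring_1 set \<Rightarrow> 'a \<Rightarrow> bool" where
  "integral_over R x \<longleftrightarrow> (\<exists>p. lead_coeff p = 1 \<and> range (coeff p) \<subseteq> R \<and> poly p x = 0)"

text \<open>
  For a subring \<open>R\<close> of an integral domain \<open>'a\<close>; such an \<open>R\<close> is itself a domain, and its field of
  fractions is the set of all \<open>Fract a b\<close> with \<open>a, b \<in> R\<close>, \<open>b \<noteq> 0\<close> inside the field of fractions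
  \<open>'a fract\<close> of the ambient domain, with \<open>R\<close> embedded by \<open>r \<mapsto> Fract r 1\<close>.
  Normality thus amounts to integral closedness of \<open>R\<close> in that field.
\<close>

definition fractions_of :: "'a::idom set \<Rightarrow> 'a fract set" where
  "fractions_of R = {Fract a b | a b. a \<in> R \<and> b \<in> R \<and> b \<noteq> 0}"

definition normal_domain :: "'a::idom set \<Rightarrow> bool" where
  "normal_domain R \<longleftrightarrow>
     (\<forall>x \<in> fractions_of R. integral_over ((\<lambda>r. Fract r 1) ` R) x \<longrightarrow> x \<in> (\<lambda>r. Fract r 1) ` R)"

definition normal_polytope ::
    "'k::field itself \<Rightarrow> (real ^ 'n::{finite,linorder}) set \<Rightarrow> bool" where
  "normal_polytope _ P \<longleftrightarrow> normal_domain (toric_ring P :: ('n, 'k) laurent poly set)"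


section \<open>Unimodular triangulations\<close>

text \<open>
  The library's \<open>triangulation\<close> is a finite set of simplices meeting in common faces; it is not
  required to contain all faces of its members, which does not affect the maximal simplices.
\<close>

definition lattice_triangulation_of :: "(real ^ 'n) set set \<Rightarrow> (real ^ 'n) set \<Rightarrow> bool" where
  "lattice_triangulation_of \<T> P \<longleftrightarrow>
     triangulation \<T> \<and> \<Union>\<T> = P \<and> (\<forall>T\<in>\<T>. {v. v extreme_point_of T} \<subseteq> int_lattice)"

definition unimodular_triangulation_of :: "(real ^ 'n) set set \<Rightarrow> (real ^ 'n) set \<Rightarrow> bool" where
  "unimodular_triangulation_of \<T> P \<longleftrightarrow>
     lattice_triangulation_of \<T> P \<and>
     (\<forall>T\<in>\<T>. (\<forall>T'\<in>\<T>. T \<subseteq> T' \<longrightarrow> T' = T) \<longrightarrow> fact CARD('n) * measure lebesgue T = 1)"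


section \<open>The delta-matroid in question\<close>

text \<open>The numeral type \<open>4\<close> has exactly the elements \<open>1, 2, 3, 4\<close> (with \<open>4 = 0\<close>).\<close>

definition F_star :: "4 set set" where
  "F_star = {{}, {4}} \<union> {X. X \<subseteq> {1, 2, 3, 4} \<and> card X = 2} \<union> {{1, 2, 3, 4}}"

definition P_star :: "(real ^ 4) set" where
  "P_star = convex hull
     {vector [0,0,0,0], vector [0,0,0,1], vector [1,1,0,0], vector [1,0,1,0], vector [1,0,0,1],
      vector [0,1,1,0], vector [0,1,0,1], vector [0,0,1,1], vector [1,1,1,1]}"

lemma vector_4_nth [simp]:
  "(vector [w, x, y, z] :: 'a::zero ^ 4) $ 1 = w"
  "(vector [w, x, y, z] :: 'a::zero ^ 4) $ 2 = x"
  "(vector [w, x, y, z] :: 'a::zero ^ 4) $ 3 = y"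
  "(vector [w, x, y, z] :: 'a::zero ^ 4) $ 4 = z"
  by (simp_all add: vector_def)

end

theory Submission
  imports Defs
begin

text \<open>
  Everything negative rests on the point \<open>1110\<close>. It equals half of
  \<open>0000 + 1100 + 1010 + 0110\<close>, so it lies in twice the polytope. The lattice points of the polytope are
  its nine vertices, since a lattice point of the cube is an extreme point of the cube. Each of the
  nine lies in the submonoid of \<open>\<int>\<^sup>4\<close> consisting of all \<open>e\<close> with \<open>e\<^sub>4 \<ge> 0\<close> whose coordinate sum is
  even in case \<open>e\<^sub>4 = 0\<close> (\<open>parity_monoid\<close>), whereas \<open>1110\<close> has last coordinate \<open>0\<close> and odd sum \<open>3\<close>.
  Hence \<open>1110\<close> is not a sum of vertices, and integer decomposition already fails for \<open>k = 2\<close>.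
  
  The same monoid refutes normality: exponents of elements of the toric ring stay inside it
  (\<open>toric_ring_support\<close>), so \<open>t\<^sup>2 z\<^sup>1\<^sup>1\<^sup>1\<^sup>0\<close> is missing from the ring. Nevertheless this monomial is integral,
  its square being the product of the generators at \<open>0000\<close>, \<open>1100\<close>, \<open>1010\<close>, \<open>0110\<close>, and it lies in the
  field of fractions because \<open>1110 = 1001 + 0101 + 0011 - 3 \<cdot> 0001 + 2 \<cdot> 0000\<close>, an integer combination of
  total weight \<open>2\<close> (\<open>normal_polytope_monomial_mem\<close>). The five points used here also show that the
  vertices affinely generate the lattice.
  
  That no unimodular triangulation exists follows from the general fact that such a triangulation
  forces integer decomposition (\<open>unimodular_triangulation_imp_idp\<close>): by Cramer's rule, the barycentric
  coordinates of \<open>x / k\<close> in a unimodular simplex become integers after multiplication by \<open>k\<close>.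
  
  Finally, the feasible sets are the even subsets of \<open>[4]\<close> together with the single odd set \<open>{4}\<close>, and
  adding one odd set to all even sets always gives a delta-matroid.
\<close>


section \<open>Zero-one points\<close>

definition cube_vertices :: "(real ^ 'n) set" where
  "cube_vertices = {v. \<forall>i. v $ i = 0 \<or> v $ i = 1}"

lemma cube_vertices_subset_cbox: "cube_vertices \<subseteq> cbox 0 (1 :: real ^ 'n)"
proof
  fix v :: "real ^ 'n" assume v: "v \<in> cube_vertices"
  have "0 \<le> v $ i \<and> v $ i \<le> 1" for i
  proof -
    from v have "v $ i = 0 \<or> v $ i = 1"
      by (simp add: cube_vertices_def)
    then show ?thesis
      by auto
  qed
  then show "v \<in> cbox 0 1"
    by (simp add: mem_box_cart)
qed

lemma cube_vertices_subset_int_lattice: "cube_vertices \<subseteq> int_lattice"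
  unfolding cube_vertices_def int_lattice_def by (auto, metis Ints_0 Ints_1)

text \<open>
  A coordinate of a proper convex combination of numbers in \<open>[0,1]\<close> is \<open>0\<close> or \<open>1\<close> only if both numbers
  agree there, so a 0/1 point inside any segment of the cube forces its end points to coincide.
\<close>

lemma cube_vertex_extreme_in_hull:
  fixes S :: "(real ^ 'n) set"
  assumes S: "S \<subseteq> cube_vertices" and v: "v \<in> convex hull S" "v \<in> cube_vertices"
  shows "v extreme_point_of (convex hull S)"
proof -
  have "S \<subseteq> cbox 0 1"
    using S cube_vertices_subset_cbox by blast
  then have hull: "convex hull S \<subseteq> cbox 0 1"
    by (simp add: hull_minimal)
  have "v \<notin> open_segment a b" if "a \<in> cbox 0 1" "b \<in> cbox 0 1" for a b :: "real ^ 'n"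
  proof
    assume "v \<in> open_segment a b"
    then obtain u where u: "a \<noteq> b" "0 < u" "u < 1" "v = (1 - u) *\<^sub>R a + u *\<^sub>R b"
      by (auto simp: in_segment)
    have "a $ i = b $ i" for i
    proof -
      have ab: "0 \<le> a $ i" "a $ i \<le> 1" "0 \<le> b $ i" "b $ i \<le> 1"
        using that by (auto simp: mem_box_cart)
      have vi: "v $ i = (1 - u) * a $ i + u * b $ i"
        using u(4) by simp
      from v(2) consider "v $ i = 0" | "v $ i = 1"
        by (auto simp: cube_vertices_def)
      then show ?thesis
      proof cases
        case 1
        have "0 \<le> (1 - u) * a $ i" "0 \<le> u * b $ i"
          using u ab by simp_all
        then have "(1 - u) * a $ i = 0" "u * b $ i = 0"
          using vi 1 by linarith+
        then show ?thesis
          using u by simp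
      next
        case 2
        have "0 \<le> (1 - u) * (1 - a $ i)" "0 \<le> u * (1 - b $ i)"
          using u ab by simp_all
        moreover have "(1 - u) * (1 - a $ i) + u * (1 - b $ i) = 0"
          using vi 2 by (simp add: algebra_simps)
        ultimately have "(1 - u) * (1 - a $ i) = 0" "u * (1 - b $ i) = 0"
          by linarith+
        then show ?thesis
          using u by simp
      qed
    qed
    then show False
      using u(1) by (simp add: vec_eq_iff)
  qed
  then show ?thesis
    using v(1) hull by (auto simp: extreme_point_of_def)
qed

lemma extreme_points_hull_cube_vertices:
  assumes "S \<subseteq> cube_vertices"
  shows "{v. v extreme_point_of (convex hull S)} = S"
  using assms cube_vertex_extreme_in_hull extreme_point_of_convex_hull hull_inc
  by (metis (no_types, lifting) Collect_cong Collect_mem_eq subsetD)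

text \<open>
  A lattice point of the hull is a 0/1 point, hence extreme in the hull, and extreme points of a hull
  belong to the generating set.
\<close>

lemma lattice_points_hull_cube_vertices:
  assumes S: "S \<subseteq> cube_vertices"
  shows "convex hull S \<inter> int_lattice = S"
proof
  show "S \<subseteq> convex hull S \<inter> int_lattice"
    using S cube_vertices_subset_int_lattice hull_subset[of S convex] by blast
next
  have "S \<subseteq> cbox 0 1"
    using S cube_vertices_subset_cbox by blast
  then have hull: "convex hull S \<subseteq> cbox 0 1"
    by (simp add: hull_minimal)
  show "convex hull S \<inter> int_lattice \<subseteq> S"
  proof
    fix v assume v: "v \<in> convex hull S \<inter> int_lattice"
    have "v $ i = 0 \<or> v $ i = 1" for i
    proof -
      have "0 \<le> v $ i" "v $ i \<le> 1" "v $ i \<in> \<int>"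
        using v hull by (auto simp: mem_box_cart int_lattice_def)
      then obtain n :: int where "v $ i = of_int n" "0 \<le> n" "n \<le> 1"
        by (auto elim!: Ints_cases)
      then show ?thesis
        by (cases "n = 0") auto
    qed
    then have "v \<in> cube_vertices"
      by (simp add: cube_vertices_def)
    then show "v \<in> S"
      using v S cube_vertex_extreme_in_hull extreme_point_of_convex_hull by blast
  qed
qed


section \<open>Even sets together with one odd set\<close>

lemma even_card_sym_diff:
  assumes "finite A" "finite B"
  shows "even (card (sym_diff A B)) \<longleftrightarrow> (even (card A) \<longleftrightarrow> even (card B))"
proof -
  have "card A = card (A - B) + card (A \<inter> B)" "card B = card (B - A) + card (A \<inter> B)"
    using assms card_Int_Diff[of A B] card_Int_Diff[of B A] by (simp_all add: Int_commute)
  moreover have "card (sym_diff A B) = card (A - B) + card (B - A)"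
    using assms by (intro card_Un_disjoint) auto
  ultimately show ?thesis
    by auto
qed

text \<open>
  From an odd set, toggling \<open>u\<close> alone reaches an even set. From an even set \<open>X\<close>, toggling \<open>u\<close> and any
  other \<open>v\<close> of the symmetric difference keeps the parity; if there is no other element, then toggling
  \<open>u\<close> turns \<open>X\<close> into \<open>Y\<close>.
\<close>

lemma delta_matroid_even_sets_insert_odd:
  assumes E: "finite E" and S: "S \<subseteq> E" "odd (card S)"
  shows "delta_matroid E (insert S {X. X \<subseteq> E \<and> even (card X)})"
proof -
  let ?F = "insert S {X. X \<subseteq> E \<and> even (card X)}"
  have fin: "finite X" if "X \<subseteq> E" for X
    using that E finite_subset by blast
  have sub: "sym_diff X {u, v} \<subseteq> E" if "X \<subseteq> E" "u \<in> E" "v \<in> E" for X u v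
    using that by blast
  have "\<exists>v\<in>sym_diff X Y. sym_diff X {u, v} \<in> ?F"
    if X: "X \<in> ?F" and Y: "Y \<in> ?F" and u: "u \<in> sym_diff X Y" for X Y u
  proof -
    have XE: "X \<subseteq> E" and YE: "Y \<subseteq> E"
      using X Y S by auto
    then have uE: "u \<in> E"
      using u by blast
    consider "odd (card X)" | "even (card X)" "sym_diff X Y = {u}"
      | v where "even (card X)" "v \<in> sym_diff X Y" "v \<noteq> u"
      using u by blast
    then show ?thesis
    proof cases
      case 1
      then have "even (card (sym_diff X {u, u}))"
        using even_card_sym_diff[of X "{u}"] fin[OF XE] by simp
      then show ?thesis
        using u sub[OF XE uE uE] by blast
    next
      case 2
      then have "sym_diff X {u, u} = Y"
        by blast
      then show ?thesis
        using u Y by metis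
    next
      case 3
      then have "even (card (sym_diff X {u, v}))"
        using even_card_sym_diff[of X "{u, v}"] fin[OF XE] by simp
      moreover have "v \<in> E"
        using 3 XE YE by blast
      ultimately show ?thesis
        using 3 sub[OF XE uE] by blast
    qed
  qed
  then show ?thesis
    using E S unfolding delta_matroid_def by blast
qed


section \<open>Unimodular triangulations give integer decompositions\<close>

lemma sum_list_of_multiplicities:
  fixes n :: "(real ^ 'n) \<Rightarrow> nat"
  assumes "finite A"
  shows "\<exists>ps. length ps = sum n A \<and> set ps \<subseteq> A \<and> sum_list ps = (\<Sum>a\<in>A. real (n a) *\<^sub>R a)"
  using assms
proof (induction A)
  case (insert a A)
  then obtain ps where ps: "length ps = sum n A" "set ps \<subseteq> A"
    "sum_list ps = (\<Sum>a\<in>A. real (n a) *\<^sub>R a)"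
    by blast
  have "sum_list (replicate k a) = real k *\<^sub>R a" for k
    by (induction k) (simp_all add: algebra_simps)
  then show ?case
    using insert.hyps ps by (intro exI[of _ "replicate (n a) a @ ps"]) auto
qed simp

lemma det_integer_matrix:
  fixes A :: "real ^ 'n ^ 'n"
  assumes "\<And>i j. A $ i $ j \<in> \<int>"
  shows "det A \<in> \<int>"
  unfolding det_def using assms by (intro Ints_sum Ints_mult Ints_prod) auto

text \<open>
  By Cramer's rule, each coordinate of the solution is a quotient of integer determinants whose
  denominator is \<open>\<plusminus>1\<close>.
\<close>

lemma integer_solution_of_unimodular_system:
  fixes A :: "real ^ 'n ^ 'n"
  assumes A: "\<And>i j. A $ i $ j \<in> \<int>" and unimodular: "\<bar>det A\<bar> = 1"
    and b: "A *v x \<in> int_lattice"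
  shows "x \<in> int_lattice"
proof -
  have "x $ k \<in> \<int>" for k
  proof -
    have "det (\<chi> i j. if j = k then (A *v x) $ i else A $ i $ j) \<in> \<int>"
      using A b by (intro det_integer_matrix) (auto simp: int_lattice_def)
    then have "x $ k * det A \<in> \<int>"
      by (simp add: cramer_lemma)
    moreover have "det A = 1 \<or> det A = -1"
      using unimodular by linarith
    ultimately show ?thesis
      by (auto simp: minus_in_Ints_iff)
  qed
  then show ?thesis
    by (simp add: int_lattice_def)
qed

text \<open>
  Turns the volume condition on a simplex into a determinant condition on its edge vectors.
  The class \<open>wellorder\<close> is inherited from the change of variables formula for linear maps.
\<close>

lemma measure_simplex_image:
  fixes A :: "real ^ 'n::{finite,wellorder} ^ 'n::_"
  shows "fact CARD('n) * measure lebesgue ((\<lambda>y. v + A *v y) ` (convex hull (insert 0 Basis)))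
         = \<bar>det A\<bar>"
proof -
  let ?\<Delta> = "convex hull (insert 0 Basis) :: (real ^ 'n::_) set"
  have comp: "compact ?\<Delta>"
    by (intro compact_convex_hull finite_imp_compact) simp
  have "(\<lambda>y. v + A *v y) ` ?\<Delta> = (+) v ` ((*v) A ` ?\<Delta>)"
    by (simp add: image_image)
  then have "measure lebesgue ((\<lambda>y. v + A *v y) ` ?\<Delta>) = measure lebesgue ((*v) A ` ?\<Delta>)"
    by (simp only: measure_translation)
  also have "\<dots> = \<bar>det A\<bar> * measure lebesgue ?\<Delta>"
    using measure_linear_image[of "(*v) A" ?\<Delta>] comp by (simp add: lmeasurable_compact)
  also have "measure lebesgue ?\<Delta> = 1 / fact CARD('n)"
    using content_std_simplex[where 'a = "real ^ 'n::_"] comp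
    by (simp add: measure_completion borel_compact)
  finally show ?thesis
    by simp
qed

lemma Basis_vec_eq_range_axis: "(Basis :: (real ^ 'n) set) = range (\<lambda>j. axis j 1)"
  by (auto simp: Basis_vec_def)

lemma simplex_parametrization:
  fixes f :: "'n::finite \<Rightarrow> real ^ 'n" and v :: "real ^ 'n"
  defines "A \<equiv> (\<chi> i j. (f j - v) $ i) :: real ^ 'n ^ 'n"
  shows "convex hull (insert v (range f)) = (\<lambda>y. v + A *v y) ` (convex hull (insert 0 Basis))"
proof -
  have col: "A *v axis j 1 = f j - v" for j
    by (simp add: matrix_vector_mult_basis column_def A_def vec_eq_iff)
  have "(\<lambda>y. v + A *v y) ` insert 0 Basis = insert v (range f)"
    unfolding Basis_vec_eq_range_axis image_insert image_image col by simp
  moreover have "(\<lambda>y. v + A *v y) ` (convex hull (insert 0 Basis))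
      = convex hull ((\<lambda>y. v + A *v y) ` insert 0 Basis)"
  proof -
    have "(\<lambda>y. v + A *v y) ` X = (+) v ` ((*v) A ` X)" for X
      by (simp add: image_image)
    then show ?thesis
      by (simp only: convex_hull_translation convex_hull_linear_image[OF matrix_vector_mul_linear])
  qed
  ultimately show ?thesis
    by simp
qed

text \<open>
  Positive volume forces \<open>n + 1\<close> vertices. Taking one vertex \<open>v\<close> as origin, the edge vectors form an
  integer matrix \<open>A\<close> with determinant \<open>\<plusminus>1\<close>, and \<open>p = v + A y\<close> for some \<open>y \<ge> 0\<close> of coordinate sum at
  most \<open>1\<close>. Then \<open>A (k y)\<close> is a lattice point, so \<open>k y\<close> is an integer vector; its entries are the
  multiplicities of the other vertices, and \<open>v\<close> takes the remaining multiplicity.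
\<close>

lemma unimodular_simplex_decomposition:
  fixes C :: "(real ^ 'n::{finite,wellorder}) set"
  assumes C: "C \<subseteq> int_lattice" "finite C" "\<not> affine_dependent C"
    and vol: "fact CARD('n) * measure lebesgue (convex hull C) = 1"
    and p: "p \<in> convex hull C" and kp: "real k *\<^sub>R p \<in> int_lattice"
  shows "\<exists>ps. length ps = k \<and> set ps \<subseteq> C \<and> real k *\<^sub>R p = sum_list ps"
proof -
  have card: "card C = CARD('n) + 1"
  proof (rule antisym)
    have "int (card C) \<le> int CARD('n) + 1"
      using aff_dim_affine_independent[OF C(3)] aff_dim_le_DIM[of C] by simp
    then show "card C \<le> CARD('n) + 1"
      by linarith
    show "CARD('n) + 1 \<le> card C"
    proof (rule ccontr)
      assume "\<not> CARD('n) + 1 \<le> card C"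
      then have "interior (convex hull C) = {}"
        using C(2) by (intro empty_interior_convex_hull) auto
      then have "negligible (convex hull C)"
        by (simp add: negligible_convex_interior)
      then show False
        using vol by (simp add: negligible_imp_measure0)
    qed
  qed
  then obtain v where v: "v \<in> C"
    by fastforce
  have "card (UNIV :: 'n set) = card (C - {v})"
    using card v C(2) by simp
  then obtain f where f: "bij_betw f (UNIV :: 'n set) (C - {v})"
    using finite_same_card_bij[of "UNIV :: 'n set" "C - {v}"] C(2) by auto
  have rf: "range f = C - {v}"
    using f by (simp add: bij_betw_def)
  then have fC: "C = insert v (range f)"
    using v by blast
  define A where "A = (\<chi> i j. (f j - v) $ i)"
  have par: "convex hull C = (\<lambda>y. v + A *v y) ` (convex hull (insert 0 Basis))"
    unfolding fC A_def by (rule simplex_parametrization)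
  have det: "\<bar>det A\<bar> = 1"
    using vol by (simp only: par measure_simplex_image)
  obtain y where y: "y \<in> convex hull (insert 0 Basis)" "p = v + A *v y"
    using p par by blast
  have nonneg: "0 \<le> y $ j" for j
  proof -
    have "axis j 1 \<in> (Basis :: (real ^ 'n::_) set)"
      by (simp add: Basis_vec_eq_range_axis)
    then have "0 \<le> y \<bullet> axis j 1"
      using y(1) by (simp add: std_simplex)
    then show ?thesis
      by (simp add: inner_axis)
  qed
  have sum_le: "(\<Sum>j\<in>UNIV. y $ j) \<le> 1"
  proof -
    have "(\<Sum>i\<in>(Basis :: (real ^ 'n::_) set). y \<bullet> i) = (\<Sum>j\<in>UNIV. y $ j)"
      unfolding Basis_vec_eq_range_axis
      by (simp add: sum.reindex inj_def axis_eq_axis inner_axis)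
    then show ?thesis
      using y(1) by (simp add: std_simplex)
  qed
  have vL: "v \<in> int_lattice" and fL: "f j \<in> int_lattice" for j
    using C(1) fC by auto
  have "A *v (real k *\<^sub>R y) = real k *\<^sub>R p - real k *\<^sub>R v"
    by (simp add: y(2) matrix_vector_mult_scaleR algebra_simps)
  then have "A *v (real k *\<^sub>R y) \<in> int_lattice"
    using kp vL by (auto simp: int_lattice_def)
  moreover have "A $ i $ j \<in> \<int>" for i j
    using vL fL by (auto simp: A_def int_lattice_def)
  ultimately have kyL: "real k *\<^sub>R y \<in> int_lattice"
    using integer_solution_of_unimodular_system det by blast
  define m where "m j = nat \<lfloor>real k * y $ j\<rfloor>" for j
  have m: "real (m j) = real k * y $ j" for j
  proof -
    have "real k * y $ j \<in> \<int>"
      using kyL by (simp add: int_lattice_def)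
    then show ?thesis
      using nonneg[of j] by (simp add: m_def)
  qed
  have msum: "(\<Sum>j\<in>UNIV. m j) \<le> k"
  proof -
    have "real (\<Sum>j\<in>UNIV. m j) = real k * (\<Sum>j\<in>UNIV. y $ j)"
      by (simp add: m sum_distrib_left)
    also have "\<dots> \<le> real k"
      using sum_le by (simp add: mult_left_le)
    finally show ?thesis
      by (simp only: of_nat_le_iff)
  qed
  \<comment> \<open>Natural subtraction is exact here: \<open>\<Sum>j. m j \<le> k\<close> by \<open>msum\<close>.\<close>
  define n where "n c = (if c = v then k - (\<Sum>j\<in>UNIV. m j) else m (the_inv f c))" for c
  have inj: "inj f"
    using f by (simp add: bij_betw_def)
  have nv: "n v = k - (\<Sum>j\<in>UNIV. m j)"
    by (simp add: n_def)
  have nf: "n (f j) = m j" for j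
    using rf inj by (auto simp: n_def the_inv_f_f)
  have notin: "v \<notin> range f"
    using rf by blast
  have "sum n C = k"
    using msum notin inj by (simp add: fC sum.reindex nv nf)
  moreover have "(\<Sum>c\<in>C. real (n c) *\<^sub>R c) = real k *\<^sub>R p"
  proof -
    have "(\<Sum>c\<in>C. real (n c) *\<^sub>R c) = real (n v) *\<^sub>R v + (\<Sum>j\<in>UNIV. real (m j) *\<^sub>R f j)"
      using notin inj by (simp add: fC sum.reindex nf)
    also have "\<dots> = real k *\<^sub>R v + (\<Sum>j\<in>UNIV. real (m j) *\<^sub>R (f j - v))"
      using msum by (simp add: nv of_nat_diff scaleR_diff_right sum_subtractf scaleR_left_diff_distrib
          scaleR_left.sum)
    also have "(\<Sum>j\<in>UNIV. real (m j) *\<^sub>R (f j - v)) = real k *\<^sub>R (A *v y)"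
      by (simp add: vec_eq_iff m A_def matrix_vector_mult_def sum_distrib_left mult_ac)
    finally show ?thesis
      by (simp add: y(2) scaleR_add_right)
  qed
  ultimately show ?thesis
    using sum_list_of_multiplicities[OF C(2), of n] by metis
qed

text \<open>
  Only maximal simplices are known to be unimodular, so the cell containing \<open>x / k\<close> is first enlarged
  to a maximal one.
\<close>

lemma unimodular_triangulation_imp_idp:
  fixes P :: "(real ^ 'n::{finite,wellorder}) set"
  assumes T: "unimodular_triangulation_of \<T> P"
  shows "integer_decomposition_property P"
  unfolding integer_decomposition_property_def
proof (intro allI impI ballI)
  fix k :: nat and x :: "real ^ 'n::_"
  assume "x \<in> (\<lambda>p. real k *\<^sub>R p) ` P \<inter> int_lattice"
  then obtain p where p: "p \<in> P" "x = real k *\<^sub>R p" "real k *\<^sub>R p \<in> int_lattice"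
    by blast
  have fin: "finite \<T>" and simp: "\<And>T. T \<in> \<T> \<Longrightarrow> \<exists>n. n simplex T" and union: "\<Union>\<T> = P"
    and verts: "\<And>T. T \<in> \<T> \<Longrightarrow> {v. v extreme_point_of T} \<subseteq> int_lattice"
    and vol: "\<And>T. \<lbrakk>T \<in> \<T>; \<forall>T'\<in>\<T>. T \<subseteq> T' \<longrightarrow> T' = T\<rbrakk> \<Longrightarrow> fact CARD('n) * measure lebesgue T = 1"
    using T unfolding unimodular_triangulation_of_def lattice_triangulation_of_def triangulation_def
    by blast+
  obtain S where "S \<in> \<T>" "p \<in> S"
    using p(1) union by blast
  then obtain T where T: "T \<in> \<T>" "p \<in> T" "\<forall>T'\<in>\<T>. T \<subseteq> T' \<longrightarrow> T' = T"
    using finite_has_maximal2[OF fin] by (metis subsetD)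
  obtain C where C: "finite C" "\<not> affine_dependent C" "T = convex hull C"
    using simp[OF T(1)] by (auto simp: simplex)
  have "{v. v extreme_point_of T} = C"
    using C by (simp add: extreme_point_of_convex_hull_affine_independent)
  then have "C \<subseteq> int_lattice"
    using verts[OF T(1)] by simp
  then obtain ps where ps: "length ps = k" "set ps \<subseteq> C" "real k *\<^sub>R p = sum_list ps"
    using unimodular_simplex_decomposition[OF _ C(1,2)] vol[OF T(1,3)] T(2) p(3) C(3) by blast
  have "C \<subseteq> P"
    using C(3) T(1) union hull_subset[of C convex] by blast
  then show "\<exists>ps. length ps = k \<and> set ps \<subseteq> P \<inter> int_lattice \<and> x = sum_list ps"
    using ps p(2) \<open>C \<subseteq> int_lattice\<close> by blast
qed


section \<open>Monomials in a toric ring\<close>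

text \<open>
  The exponent vector underlying \<open>z_monomial\<close>. Because of the floor, additivity is only guaranteed on
  lattice points.
\<close>

definition exponent :: "real ^ 'n \<Rightarrow> ('n \<Rightarrow>\<^sub>0 int)" where
  "exponent a = Abs_poly_mapping (\<lambda>i. \<lfloor>a $ i\<rfloor>)"

lemma lookup_exponent [simp]: "Poly_Mapping.lookup (exponent a) i = \<lfloor>a $ i\<rfloor>"
  by (simp add: exponent_def)

lemma exponent_0 [simp]: "exponent 0 = 0"
  by (rule poly_mapping_eqI) simp

lemma exponent_add:
  assumes "a \<in> int_lattice" "b \<in> int_lattice"
  shows "exponent (a + b) = exponent a + exponent b"
proof (rule poly_mapping_eqI)
  fix i
  obtain m n where "a $ i = of_int m" "b $ i = of_int n"
    using assms by (metis (mono_tags, lifting) Ints_cases int_lattice_def mem_Collect_eq)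
  then show "Poly_Mapping.lookup (exponent (a + b)) i = Poly_Mapping.lookup (exponent a + exponent b) i"
    by (simp add: lookup_add flip: of_int_add)
qed

lemma int_lattice_add: "a \<in> int_lattice \<Longrightarrow> b \<in> int_lattice \<Longrightarrow> a + b \<in> int_lattice"
  by (auto simp: int_lattice_def)

lemma int_lattice_sum_list: "set as \<subseteq> int_lattice \<Longrightarrow> sum_list as \<in> int_lattice"
  by (induction as) (auto intro: int_lattice_add simp: int_lattice_def)

text \<open>
  The term \<open>c t\<^sup>k z\<^sup>x\<close>.
\<close>

definition toric_monomial :: "'k::comm_ring_1 \<Rightarrow> real ^ 'n \<Rightarrow> nat \<Rightarrow> ('n, 'k) laurent poly" where
  "toric_monomial c x k = monom (Poly_Mapping.single (exponent x) c) k"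

lemma toric_monomial_mult:
  assumes "x \<in> int_lattice" "y \<in> int_lattice"
  shows "toric_monomial c x k * toric_monomial d y l = toric_monomial (c * d) (x + y) (k + l)"
  by (simp add: toric_monomial_def mult_monom mult_single exponent_add[OF assms])

lemma toric_monomial_power:
  assumes "x \<in> int_lattice"
  shows "toric_monomial 1 x k ^ n = toric_monomial 1 (real n *\<^sub>R x) (n * k)"
proof (induction n)
  case 0
  show ?case
    by (simp add: toric_monomial_def monom_0 one_pCons)
next
  case (Suc n)
  have "real n *\<^sub>R x \<in> int_lattice"
    using assms by (auto simp: int_lattice_def)
  then show ?case
    using Suc assms by (simp add: toric_monomial_mult algebra_simps)
qed

lemma toric_monomial_sum_list_mem:
  fixes P :: "(real ^ 'n::{finite,linorder}) set" and c :: "'k::comm_ring_1"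
  assumes as: "set as \<subseteq> P \<inter> int_lattice"
  shows "toric_monomial c (sum_list as) (length as) \<in> toric_ring P"
proof -
  define m where "m = Abs_poly_mapping (count (mset as))"
  have lm: "Poly_Mapping.lookup m = count (mset as)"
    unfolding m_def by (rule Abs_poly_mapping_inverse) (simp add: count_eq_zero_iff flip: set_mset_def)
  have km: "Poly_Mapping.keys m = set as"
    by (auto simp: in_keys_iff lm count_eq_zero_iff)
  let ?g = "\<lambda>a. monom (z_monomial a) 1 :: ('n, 'k) laurent poly"
  have g: "?g a = toric_monomial 1 a 1" for a
    by (simp add: toric_monomial_def z_monomial_def exponent_def)
  have "(\<Prod>a \<in> Poly_Mapping.keys m. ?g a ^ Poly_Mapping.lookup m a) = prod_mset (image_mset ?g (mset as))"
    by (simp add: km lm image_prod_mset_multiplicity)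
  also have "\<dots> = prod_list (map ?g as)"
    by (simp add: prod_mset_prod_list flip: mset_map)
  also have "\<dots> = toric_monomial 1 (sum_list as) (length as)"
    using as
  proof (induction as)
    case Nil
    show ?case
      by (simp add: toric_monomial_def monom_0 one_pCons)
  next
    case (Cons a as)
    then have "sum_list as \<in> int_lattice"
      by (intro int_lattice_sum_list) auto
    moreover have "prod_list (map ?g (a # as))
        = toric_monomial 1 a 1 * toric_monomial 1 (sum_list as) (length as)"
      using Cons by (simp only: list.map prod_list.Cons g) simp
    ultimately show ?case
      using Cons.prems by (simp add: toric_monomial_mult)
  qed
  finally have prod: "(\<Prod>a \<in> Poly_Mapping.keys m. ?g a ^ Poly_Mapping.lookup m a)
      = toric_monomial 1 (sum_list as) (length as)" .
  have "toric_hom (Poly_Mapping.single m c) = toric_monomial c (sum_list as) (length as)"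
  proof (cases "c = 0")
    case True
    then show ?thesis
      by (simp add: toric_hom_def toric_monomial_def)
  next
    case False
    then have "toric_hom (Poly_Mapping.single m c)
      = [:Poly_Mapping.single 0 c:] * toric_monomial 1 (sum_list as) (length as)"
      by (simp add: toric_hom_def flip: prod)
    then show ?thesis
      by (simp add: toric_monomial_def smult_monom mult_single)
  qed
  moreover have "Poly_Mapping.single m c \<in> polynomial_ring (P \<inter> int_lattice)"
    using as km by (auto simp: polynomial_ring_def split: if_splits)
  ultimately show ?thesis
    unfolding toric_ring_def by (metis image_eqI)
qed

text \<open>
  The Laurent polynomials in \<open>t\<close> and \<open>z\<close> whose exponents in \<open>z\<close> lie in a submonoid \<open>M\<close> form a ring
  containing the constants, so it contains the toric ring as soon as it contains the generators.
\<close>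

lemma toric_ring_support:
  fixes M :: "('n::{finite,linorder} \<Rightarrow>\<^sub>0 int) set"
  assumes M: "0 \<in> M" "\<And>a b. a \<in> M \<Longrightarrow> b \<in> M \<Longrightarrow> a + b \<in> M"
    and P: "exponent ` (P \<inter> int_lattice) \<subseteq> M"
    and q: "q \<in> (toric_ring P :: ('n, 'k::comm_ring_1) laurent poly set)"
  shows "Poly_Mapping.keys (coeff q i) \<subseteq> M"
proof -
  define S :: "('n, 'k) laurent poly set" where "S = {q. \<forall>i. Poly_Mapping.keys (coeff q i) \<subseteq> M}"
  have S_sum: "sum h I \<in> S" if "\<And>i. i \<in> I \<Longrightarrow> h i \<in> S" for h :: "'x \<Rightarrow> _" and I
    unfolding S_def coeff_sum mem_Collect_eq
    using that by (intro allI order_trans[OF keys_sum UN_least]) (auto simp: S_def)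
  have S_mult: "a * b \<in> S" if "a \<in> S" "b \<in> S" for a b
  proof -
    have "Poly_Mapping.keys (\<Sum>i\<le>n. coeff a i * coeff b (n - i)) \<subseteq> M" for n
    proof (rule order_trans[OF keys_sum UN_least])
      fix i
      show "Poly_Mapping.keys (coeff a i * coeff b (n - i)) \<subseteq> M"
        using keys_mult[of "coeff a i" "coeff b (n - i)"] that M(2) unfolding S_def by blast
    qed
    then show ?thesis
      by (simp add: S_def coeff_mult)
  qed
  have S_const: "[:Poly_Mapping.single 0 c:] \<in> S" for c
    using M(1) by (auto simp: S_def coeff_pCons split: nat.split)
  have S_1: "1 \<in> S"
    using S_const[of 1] by (simp add: one_pCons)
  have S_gen: "monom (z_monomial a) 1 \<in> S" if "a \<in> P \<inter> int_lattice" for a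
    using that P by (auto simp: S_def z_monomial_def coeff_monom exponent_def)
  have S_power: "a ^ n \<in> S" if "a \<in> S" for a n
    by (induction n) (simp_all add: S_1 S_mult that)
  have S_prod: "prod h I \<in> S" if "\<And>i. i \<in> I \<Longrightarrow> h i \<in> S" for h :: "real ^ 'n::_ \<Rightarrow> _" and I
    using that by (induction I rule: infinite_finite_induct) (simp_all add: S_1 S_mult)
  obtain f where f: "f \<in> polynomial_ring (P \<inter> int_lattice)" "q = toric_hom f"
    using q by (auto simp: toric_ring_def)
  have "q \<in> S"
    unfolding f(2) toric_hom_def
  proof (intro S_sum S_mult S_const S_prod S_power S_gen)
    fix m a assume "m \<in> Poly_Mapping.keys f" "a \<in> Poly_Mapping.keys m"
    then show "a \<in> P \<inter> int_lattice"
      using f(1) unfolding polynomial_ring_def by blast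
  qed
  then show ?thesis
    by (simp add: S_def)
qed

text \<open>
  The lists \<open>as\<close> and \<open>bs\<close> exhibit \<open>t\<^sup>k z\<^sup>x\<close> as a quotient of two elements of the toric ring, and \<open>cs\<close>
  exhibits its \<open>n\<close>-th power as an element \<open>r\<close> of the ring. Thus \<open>t\<^sup>k z\<^sup>x\<close> is a root of the monic
  polynomial \<open>X\<^sup>n - r\<close>, and normality puts it into the ring.
\<close>

lemma normal_polytope_monomial_mem:
  fixes P :: "(real ^ 'n::{finite,linorder}) set"
  assumes normal: "normal_polytope TYPE('k::field) P"
    and x: "x \<in> int_lattice"
    and as: "set as \<subseteq> P \<inter> int_lattice" and bs: "set bs \<subseteq> P \<inter> int_lattice"
    and diff: "x + sum_list bs = sum_list as" "k + length bs = length as"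
    and cs: "set cs \<subseteq> P \<inter> int_lattice"
    and mult: "real n *\<^sub>R x = sum_list cs" "n * k = length cs" "n \<ge> 1"
  shows "toric_monomial 1 x k \<in> (toric_ring P :: ('n, 'k) laurent poly set)"
proof -
  let ?R = "toric_ring P :: ('n, 'k) laurent poly set"
  let ?\<iota> = "\<lambda>r :: ('n, 'k) laurent poly. Fract r 1"
  define y :: "('n, 'k) laurent poly" where "y = toric_monomial 1 x k"
  define b :: "('n, 'k) laurent poly" where "b = toric_monomial 1 (sum_list bs) (length bs)"
  have nz: "b \<noteq> 0"
    by (simp add: b_def toric_monomial_def monom_eq_0_iff) (metis single_zero lookup_single_eq lookup_zero zero_neq_one)
  have "y * b = toric_monomial 1 (sum_list as) (length as)"
    using bs unfolding y_def b_def
    by (subst toric_monomial_mult) (auto simp: x diff intro: int_lattice_sum_list)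
  then have "y * b \<in> ?R" "b \<in> ?R"
    using toric_monomial_sum_list_mem[OF as] toric_monomial_sum_list_mem[OF bs] by (simp_all add: b_def)
  moreover have "?\<iota> y = Fract (y * b) b"
    using nz by (simp add: eq_fract)
  ultimately have frac: "?\<iota> y \<in> fractions_of ?R"
    unfolding fractions_of_def using nz by blast
  have pow: "y ^ n = toric_monomial 1 (sum_list cs) (length cs)"
    by (simp add: y_def toric_monomial_power x mult)
  \<comment> \<open>The empty product of generators gives the constants.\<close>
  have const: "[:Poly_Mapping.single 0 c:] \<in> ?R" for c
    using toric_monomial_sum_list_mem[of "[]" P c] by (simp add: toric_monomial_def monom_0)
  have R0: "0 \<in> ?R" and R1: "1 \<in> ?R"
    using const[of 0] const[of 1] by (simp_all add: one_pCons)
  have "- (y ^ n) = toric_monomial (-1) (sum_list cs) (length cs)"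
    by (simp add: pow toric_monomial_def single_uminus flip: minus_monom)
  then have Rn: "- (y ^ n) \<in> ?R"
    using toric_monomial_sum_list_mem[OF cs] by simp
  have \<iota>_pow: "?\<iota> (y ^ j) = ?\<iota> y ^ j" for j
  proof (induction j)
    case (Suc j)
    have "?\<iota> (y ^ Suc j) = ?\<iota> y * ?\<iota> (y ^ j)"
      by simp
    then show ?case
      by (simp only: Suc power_Suc)
  qed (simp add: One_fract_def)
  define p where "p = [:?\<iota> (- (y ^ n)):] + monom 1 n"
  have "degree [:?\<iota> (- (y ^ n)):] < degree (monom (1 :: ('n, 'k) laurent poly fract) n)"
    using mult(3) by (simp add: degree_monom_eq)
  then have "lead_coeff p = 1"
    by (simp only: p_def lead_coeff_add_le) (simp add: degree_monom_eq)
  moreover have "poly p (?\<iota> y) = 0"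
    by (simp add: p_def poly_monom fract_collapse flip: \<iota>_pow)
  moreover have "range (coeff p) \<subseteq> ?\<iota> ` ?R"
  proof -
    have "coeff p i \<in> {?\<iota> 0, ?\<iota> 1, ?\<iota> (- (y ^ n))}" for i
      using mult(3) by (auto simp: p_def coeff_pCons fract_collapse split: nat.split)
    then show ?thesis
      using R0 R1 Rn by blast
  qed
  ultimately have "integral_over (?\<iota> ` ?R) (?\<iota> y)"
    unfolding integral_over_def by blast
  then have "?\<iota> y \<in> ?\<iota> ` ?R"
    using frac normal unfolding normal_polytope_def normal_domain_def by blast
  then obtain q where "q \<in> ?R" "?\<iota> y = ?\<iota> q"
    by blast
  then show ?thesis
    by (simp add: eq_fract y_def)
qed


section \<open>The polytope in question\<close>

definition V_star :: "(real ^ 4) set" where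
  "V_star =
     {vector [0,0,0,0], vector [0,0,0,1], vector [1,1,0,0], vector [1,0,1,0], vector [1,0,0,1],
      vector [0,1,1,0], vector [0,1,0,1], vector [0,0,1,1], vector [1,1,1,1]}"

text \<open>
  Closed under addition because two nonnegative last coordinates add up to \<open>0\<close> only if both vanish, in
  which case both coordinate sums are even. It separates \<open>1110\<close> from the vertices of the polytope.
\<close>

definition parity_monoid :: "(4 \<Rightarrow>\<^sub>0 int) set" where
  "parity_monoid = {e. Poly_Mapping.lookup e 4 \<ge> 0 \<and>
     (Poly_Mapping.lookup e 4 = 0 \<longrightarrow> even (\<Sum>i\<in>UNIV. Poly_Mapping.lookup e i))}"

lemma V_star_subset_cube: "V_star \<subseteq> cube_vertices"
  by (simp add: V_star_def cube_vertices_def forall_4)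

lemma P_star_hull: "P_star = convex hull V_star"
  by (simp add: P_star_def V_star_def)

lemma lattice_points_P_star: "P_star \<inter> int_lattice = V_star"
  unfolding P_star_hull by (rule lattice_points_hull_cube_vertices[OF V_star_subset_cube])

lemma parity_monoid_0: "0 \<in> parity_monoid"
  by (simp add: parity_monoid_def)

lemma parity_monoid_add:
  assumes "a \<in> parity_monoid" "b \<in> parity_monoid"
  shows "a + b \<in> parity_monoid"
  using assms by (auto simp: parity_monoid_def lookup_add sum.distrib add_nonneg_eq_0_iff)

lemma exponent_V_star: "v \<in> V_star \<Longrightarrow> exponent v \<in> parity_monoid"
  by (auto simp: V_star_def parity_monoid_def sum_4)

lemma exponent_1110_notin: "exponent (vector [1,1,1,0]) \<notin> parity_monoid"
  by (simp add: parity_monoid_def sum_4)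

lemma F_star_explicit:
  "F_star = {{}, {4}, {1,2}, {1,3}, {1,4}, {2,3}, {2,4}, {3,4}, {1,2,3,4}}"
proof -
  have "{X :: 4 set. X \<subseteq> {1, 2, 3, 4} \<and> card X = 2} = {{1,2}, {1,3}, {1,4}, {2,3}, {2,4}, {3,4}}"
    (is "?A = ?B")
  proof
    show "?A \<subseteq> ?B"
    proof
      fix X :: "4 set" assume "X \<in> ?A"
      then obtain a b where "X = {a, b}" "a \<noteq> b"
        by (auto simp: card_2_iff)
      then show "X \<in> ?B"
        using exhaust_4[of a] exhaust_4[of b] by (elim disjE) (simp_all add: doubleton_eq_iff)
    qed
    show "?B \<subseteq> ?A"
      by simp
  qed
  then show ?thesis
    unfolding F_star_def by auto
qed

lemma F_star_even_or_4: "F_star = insert {4} {X. X \<subseteq> {1, 2, 3, 4} \<and> even (card X)}"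
proof -
  have "even (card X) \<longleftrightarrow> X = {} \<or> card X = 2 \<or> X = {1, 2, 3, 4}" for X :: "4 set"
  proof -
    have "card X \<le> 4"
      using card_mono[of UNIV X] by simp
    then have "even (card X) \<longleftrightarrow> card X = 0 \<or> card X = 2 \<or> card X = 4"
      by presburger
    moreover have "card X = 4 \<longleftrightarrow> X = {1, 2, 3, 4}"
    proof
      assume "card X = 4"
      then have "card X = CARD(4)"
        by simp
      then have "X = UNIV"
        by (intro card_subset_eq) simp_all
      then show "X = {1, 2, 3, 4}"
        by (simp only: UNIV_4)
    qed simp
    ultimately show ?thesis
      by simp
  qed
  then show ?thesis
    by (auto simp: F_star_def)
qed

lemma delta_matroid_F_star: "delta_matroid {1, 2, 3, 4} F_star"
  unfolding F_star_even_or_4 by (rule delta_matroid_even_sets_insert_odd) auto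

lemma delta_matroid_polytope_F_star: "delta_matroid_polytope F_star = P_star"
proof -
  have "indicator_vec ` F_star = V_star"
    unfolding F_star_explicit V_star_def image_insert image_empty
    by (intro arg_cong2[where f = insert] refl; simp add: indicator_vec_def vec_eq_iff forall_4)
  then show ?thesis
    by (simp add: delta_matroid_polytope_def P_star_hull)
qed

lemma not_idp_P_star: "\<not> integer_decomposition_property P_star"
proof
  assume idp: "integer_decomposition_property P_star"
  let ?x = "vector [1,1,1,0] :: real ^ 4"
  let ?T = "{vector [0,0,0,0], vector [1,1,0,0], vector [1,0,1,0], vector [0,1,1,0]} :: (real ^ 4) set"
  have "convex hull ?T \<subseteq> P_star"
    unfolding P_star_hull by (rule hull_mono) (simp add: V_star_def)
  moreover have "(1/2) *\<^sub>R ?x \<in> convex hull ?T"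
  proof -
    have sums: "(\<Sum>v\<in>?T. (1/4 :: real)) = 1" "(\<Sum>v\<in>?T. (1/4) *\<^sub>R v) = (1/2) *\<^sub>R ?x"
      by (simp_all add: vec_eq_iff forall_4)
    have "finite ?T"
      by simp
    then show ?thesis
      unfolding convex_hull_finite[OF \<open>finite ?T\<close>]
      by (intro CollectI exI[of _ "\<lambda>_. 1/4"] conjI ballI) (rule sums | simp)+
  qed
  moreover have "?x \<in> int_lattice"
    by (simp add: int_lattice_def forall_4)
  ultimately have "?x \<in> (\<lambda>p. real 2 *\<^sub>R p) ` P_star \<inter> int_lattice"
    by (force simp: image_iff)
  then obtain ps where ps: "length ps = 2" "set ps \<subseteq> V_star" "?x = sum_list ps"
    using idp unfolding integer_decomposition_property_def lattice_points_P_star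
    by (metis one_le_numeral)
  then obtain v w where "v \<in> V_star" "w \<in> V_star" "?x = v + w"
    by (auto simp: length_Suc_conv numeral_2_eq_2)
  then have "exponent ?x \<in> parity_monoid"
    using exponent_add[of v w] exponent_V_star parity_monoid_add lattice_points_P_star by force
  then show False
    using exponent_1110_notin by blast
qed

text \<open>
  The differences of \<open>1001\<close>, \<open>0101\<close>, \<open>0011\<close> with \<open>0001\<close> are the first three unit vectors, and \<open>0001\<close> is
  the fourth. The weight of \<open>0000\<close> only serves to make the coefficients sum to \<open>1\<close>.
\<close>

lemma affinely_generates_P_star: "affinely_generates_lattice {v. v extreme_point_of P_star}"
proof -
  have ext: "{v. v extreme_point_of P_star} = V_star"
    unfolding P_star_hull by (rule extreme_points_hull_cube_vertices[OF V_star_subset_cube])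
  have "\<exists>T (c :: real ^ 4 \<Rightarrow> int). finite T \<and> T \<subseteq> V_star \<and> (\<Sum>v\<in>T. c v) = 1 \<and>
      x = (\<Sum>v\<in>T. of_int (c v) *\<^sub>R v)" if x: "x \<in> int_lattice" for x
  proof -
    define a where "a i = \<lfloor>x $ i\<rfloor>" for i
    have xa: "x $ i = of_int (a i)" for i
      using x by (auto simp: a_def int_lattice_def)
    let ?v1 = "vector [1,0,0,1] :: real ^ 4" and ?v2 = "vector [0,1,0,1] :: real ^ 4"
      and ?v3 = "vector [0,0,1,1] :: real ^ 4" and ?v4 = "vector [0,0,0,1] :: real ^ 4"
      and ?v0 = "vector [0,0,0,0] :: real ^ 4"
    define c where "c v = (if v = ?v1 then a 1 else if v = ?v2 then a 2 else if v = ?v3 then a 3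
      else if v = ?v4 then a 4 - a 1 - a 2 - a 3 else 1 - a 4)" for v
    have "(\<Sum>v\<in>{?v1, ?v2, ?v3, ?v4, ?v0}. c v) = 1"
      by (simp add: c_def vec_eq_iff forall_4)
    moreover have "x = (\<Sum>v\<in>{?v1, ?v2, ?v3, ?v4, ?v0}. of_int (c v) *\<^sub>R v)"
      by (simp add: c_def vec_eq_iff forall_4 xa)
    moreover have "{?v1, ?v2, ?v3, ?v4, ?v0} \<subseteq> V_star"
      by (simp add: V_star_def)
    ultimately show ?thesis
      by (intro exI[of _ "{?v1, ?v2, ?v3, ?v4, ?v0}"] exI[of _ c] conjI) simp_all
  qed
  moreover have "V_star \<subseteq> int_lattice"
    using lattice_points_P_star by blast
  ultimately show ?thesis
    unfolding ext affinely_generates_lattice_def by (intro conjI ballI)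
qed

lemma not_normal_P_star: "\<not> normal_polytope TYPE('k::field) P_star"
proof
  assume normal: "normal_polytope TYPE('k) P_star"
  let ?x = "vector [1,1,1,0] :: real ^ 4"
  have "toric_monomial 1 ?x 2 \<in> (toric_ring P_star :: (4, 'k) laurent poly set)"
  proof (rule normal_polytope_monomial_mem[OF normal, where n = 2
        and as = "[vector [1,0,0,1], vector [0,1,0,1], vector [0,0,1,1], 0, 0]"
        and bs = "[vector [0,0,0,1], vector [0,0,0,1], vector [0,0,0,1]]"
        and cs = "[0, vector [1,1,0,0], vector [1,0,1,0], vector [0,1,1,0]]"])
    have "vector [0,0,0,0] = (0 :: real ^ 4)"
      by (simp add: vec_eq_iff forall_4)
    then have V0: "0 \<in> V_star"
      by (simp add: V_star_def)
    show "?x \<in> int_lattice"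
      by (simp add: int_lattice_def forall_4)
    show "set [vector [1,0,0,1], vector [0,1,0,1], vector [0,0,1,1], 0, 0] \<subseteq> P_star \<inter> int_lattice"
      "set [vector [0,0,0,1], vector [0,0,0,1], vector [0,0,0,1]] \<subseteq> P_star \<inter> int_lattice"
      "set [0, vector [1,1,0,0], vector [1,0,1,0], vector [0,1,1,0]] \<subseteq> P_star \<inter> int_lattice"
      unfolding lattice_points_P_star using V0 by (simp_all add: V_star_def)
  qed (simp_all add: vec_eq_iff forall_4)
  then have "Poly_Mapping.keys (coeff (toric_monomial 1 ?x 2 :: (4, 'k) laurent poly) 2) \<subseteq> parity_monoid"
    by (intro toric_ring_support[where P = P_star])
      (auto simp: parity_monoid_0 parity_monoid_add lattice_points_P_star exponent_V_star)
  then show False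
    using exponent_1110_notin by (simp add: toric_monomial_def)
qed

theorem proposition1p7:
  shows "delta_matroid {1, 2, 3, 4} F_star
       \<and> delta_matroid_polytope F_star = P_star
       \<and> \<not> integer_decomposition_property P_star
       \<and> affinely_generates_lattice {v. v extreme_point_of P_star}
       \<and> \<not> normal_polytope TYPE('k::field) P_star
       \<and> (\<nexists>\<T>. unimodular_triangulation_of \<T> P_star)"
proof (intro conjI)
  show "\<nexists>\<T>. unimodular_triangulation_of \<T> P_star"
    using not_idp_P_star unimodular_triangulation_imp_idp by blast
qed (rule delta_matroid_F_star delta_matroid_polytope_F_star not_idp_P_star
    affinely_generates_P_star not_normal_P_star)+

end
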